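(* Let $\mathcal H$ be a real Hilbert space, let $f:\mathcal H\to\mathbb R\cup\{+\infty\}$ be convex, lower semicontinuous and proper with $\operatorname{argmin}_{\mathcal H}f\neq\emptyset$, and fix $\lambda>0$. Let $t_0>0$, $\alpha\ge 0$, and let $u:[t_0,+\infty[\to\mathcal H$ be a classical solution of $$\text{(TOGES-VR)}\qquad\dddot u(t)+\frac{\alpha+7}{t}\ddot u(t)+\frac{5(\alpha+1)}{t^2}\dot u(t)+\nabla f_\lambda\Big(u(t)+\tfrac14 t\dot u(t)\Big)=0,\quad t\ge t_0.$$ (a) If $\alpha\ge 3$, then as $t\to+\infty$: (i) $f_\lambda\big(u(t)+\tfrac14 t\dot u(t)\big)-\inf_{\mathcal H}f=\mathcal O(1/t^3)$ and $f\big(\operatorname{prox}_{\lambda f}(u(t)+\tfrac14 t\dot u(t))\big)-\inf_{\mathcal H}f=\mathcal O(1/t^3)$; (ii) $f_\lambda(u(t))-\inf_{\mathcal H}f=\mathcal O(1/t^3)$ and $f\big(\operatorname{prox}_{\lambda f}u(t)\big)-\inf_{\mathcal H}f=\mathcal O(1/t^3)$. (b) If $\alpha>3$, then as $t\to+\infty$: (iii) $f_\lambda\big(u(t)+\tfrac14 t\dot u(t)\big)-\inf_{\mathcal H}f=o(1/t^3)$ and $f\big(\operatorname{prox}_{\lambda f}(u(t)+\tfrac14 t\dot u(t))\big)-\inf_{\mathcal H}f=o(1/t^3)$; (iv) $f_\lambda(u(t))-\inf_{\mathcal H}f=o(1/t^3)$ and $f\big(\operatorname{prox}_{\lambda f}u(t)\big)-\inf_{\mathcal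 H}f=o(1/t^3)$; (v) $u(t)$ converges weakly to some $u_\infty\in\operatorname{argmin}_{\mathcal H}f$.
   Context: The Moreau envelope of index $\lambda>0$ is $f_\lambda(x)=\min_{\xi\in\mathcal H}\{f(\xi)+\frac1{2\lambda}\|x-\xi\|^2\}$; it is convex, continuously differentiable with Lipschitz gradient, $\inf f_\lambda=\inf f$ and $\operatorname{argmin}f_\lambda=\operatorname{argmin}f$. The proximal mapping $\operatorname{prox}_{\lambda f}x$ is the unique minimizer $\xi$ in the definition of $f_\lambda(x)$, i.e. $\operatorname{prox}_{\lambda f}=(I+\lambda\partial f)^{-1}$, so that $f_\lambda(x)=f(\operatorname{prox}_{\lambda f}x)+\frac1{2\lambda}\|x-\operatorname{prox}_{\lambda f}x\|^2$. *)

theory Defs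
  imports "HOL-Analysis.Analysis" "HOL-Library.Landau_Symbols"
begin

definition proper_fun :: "('a \<Rightarrow> ereal) \<Rightarrow> bool" where
  "proper_fun f \<longleftrightarrow> (\<forall>x. f x \<noteq> -\<infinity>) \<and> (\<exists>x. f x \<noteq> \<infinity>)"

definition convex_ext :: "('a::real_vector \<Rightarrow> ereal) \<Rightarrow> bool" where
  "convex_ext f \<longleftrightarrow> (\<forall>x y (t::real). 0 < t \<and> t < 1 \<longrightarrow>
      f ((1 - t) *\<^sub>R x + t *\<^sub>R y) \<le> ereal (1 - t) * f x + ereal t * f y)"

definition lsc_ext :: "('a::topological_space \<Rightarrow> ereal) \<Rightarrow> bool" where
  "lsc_ext f \<longleftrightarrow> (\<forall>c. closed {x. f x \<le> c})"

definition argmin_set :: "('a \<Rightarrow> ereal) \<Rightarrow> 'a set" where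
  "argmin_set f = {x. \<forall>y. f x \<le> f y}"

text \<open>Moreau envelope f_\<lambda> (real valued for proper f).\<close>
definition moreau_env :: "('a::real_normed_vector \<Rightarrow> ereal) \<Rightarrow> real \<Rightarrow> 'a \<Rightarrow> real" where
  "moreau_env f lam x = real_of_ereal (INF \<xi>. f \<xi> + ereal (norm (x - \<xi>)^2 / (2 * lam)))"

definition prox :: "('a::real_normed_vector \<Rightarrow> ereal) \<Rightarrow> real \<Rightarrow> 'a \<Rightarrow> 'a" where
  "prox f lam x = (THE \<xi>. \<forall>\<eta>. f \<xi> + ereal (norm (x - \<xi>)^2 / (2 * lam))
                                  \<le> f \<eta> + ereal (norm (x - \<eta>)^2 / (2 * lam)))"

definition grad :: "('a::real_inner \<Rightarrow> real) \<Rightarrow> 'a \<Rightarrow> 'a" where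
  "grad F x = (THE g. (F has_derivative (\<lambda>h. g \<bullet> h)) (at x))"

definition weak_conv_at_top :: "(real \<Rightarrow> 'a::real_inner) \<Rightarrow> 'a \<Rightarrow> bool" where
  "weak_conv_at_top u l \<longleftrightarrow> (\<forall>y. ((\<lambda>t. u t \<bullet> y) \<longlongrightarrow> l \<bullet> y) at_top)"

end

theory Submission
  imports Defs
begin

text \<open>Put $F = f_\lambda - \inf f$ and $y = u + \frac t4 \dot u$. Differentiating $y$ twice turns (TOGES-VR)
  into the second order flow $\ddot y + \frac{\alpha+1}t \dot y + \frac t4 \nabla F(y) = 0$. For a minimizer $z$ the
  energy $\frac{t^3}4 F(y) + \frac12 |\alpha(y - z) + t \dot y|^2$ is nonincreasing when $\alpha \ge 3$, and dissipates
  at rate $\frac{\alpha-3}4 t^2 F(y)$. When $\alpha > 3$, adding a multiple of it to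
  $W = \frac{t^3}4 F(y) + \frac{t^2}2 |\dot y|^2$ gives a nonnegative function with derivative at most $-W/t$,
  which forces $W \to 0$. Then $|y - z|$ converges for every minimizer $z$, and $y$ converges
  weakly by an Opial argument. Everything passes from $y$ to $u$ because
  $(t^4 u)^\cdot = 4 t^3 y$ exhibits $u$ as a weighted average of $y$, and to the proximal points because
  $0 \le f(\mathrm{prox}\, x) - \inf f \le F(x)$.\<close>

section \<open>Minimizers of strongly convex functions\<close>

text \<open>Strong convexity of the squared norm, as an identity rather than an inequality. It feeds
  the projection, the proximal objective and the limit of squared distances.\<close>

lemma norm_convex_combination:
  fixes x y :: "'a::real_inner"
  shows "(norm ((1 - t) *\<^sub>R x + t *\<^sub>R y))\<^sup>2 + t * (1 - t) * (norm (x - y))\<^sup>2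
    = (1 - t) * (norm x)\<^sup>2 + t * (norm y)\<^sup>2"
  unfolding power2_norm_eq_inner
  by (simp add: inner_commute algebra_simps)

text \<open>Strong convexity makes every minimizing sequence Cauchy, so completeness replaces
  compactness. The set \<open>D\<close> is kept apart from \<open>g\<close> so that the effective
  domain of an extended-valued function can be used. The quadratic growth in the conclusion is what
  later estimates exploit.\<close>

lemma strongly_convex_minimizer:
  fixes g :: "'a::{real_inner, complete_space} \<Rightarrow> real"
  assumes "D \<noteq> {}" and bdd: "\<And>x. x \<in> D \<Longrightarrow> b \<le> g x" and m: "m > 0"
    and dom: "\<And>x y t. x \<in> D \<Longrightarrow> y \<in> D \<Longrightarrow> 0 < t \<Longrightarrow> t < 1 \<Longrightarrow> (1 - t) *\<^sub>R x + t *\<^sub>R y \<in> D"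
    and conv: "\<And>x y t. x \<in> D \<Longrightarrow> y \<in> D \<Longrightarrow> 0 < t \<Longrightarrow> t < 1 \<Longrightarrow>
      g ((1 - t) *\<^sub>R x + t *\<^sub>R y) + m * (t * (1 - t) * (norm (x - y))\<^sup>2) \<le> (1 - t) * g x + t * g y"
    and closed: "\<And>c. closed {x \<in> D. g x \<le> c}"
  shows "\<exists>p\<in>D. \<forall>x\<in>D. g p + m * (norm (x - p))\<^sup>2 \<le> g x"
proof -
  define i where "i = Inf (g ` D)"
  have bb: "bdd_below (g ` D)" using bdd by (rule bdd_belowI2)
  have i_le: "i \<le> g x" if "x \<in> D" for x
    unfolding i_def using that bb by (simp add: cINF_lower)
  have "\<exists>x\<in>D. g x < i + 1 / real (Suc n)" for n
    using cInf_lessD[of "g ` D" "i + 1 / real (Suc n)"] \<open>D \<noteq> {}\<close> by (auto simp: i_def)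
  then obtain X where X: "\<And>n. X n \<in> D" "\<And>n. g (X n) < i + 1 / real (Suc n)" by metis
  \<comment> \<open>At the midpoint the strong convexity term has weight 1/2 * 1/2 = 1/4, and the
    midpoint value is still at least the infimum.\<close>
  have close: "m / 4 * (norm (X k - X n))\<^sup>2 \<le> 1 / real (Suc N)" if "N \<le> k" "N \<le> n" for k n N
  proof -
    have "i + m / 4 * (norm (X k - X n))\<^sup>2 \<le> (g (X k) + g (X n)) / 2"
      using i_le[OF dom[OF X(1)[of k] X(1)[of n], of "1/2"]] conv[OF X(1)[of k] X(1)[of n], of "1/2"]
      by (simp add: field_simps)
    moreover have "g (X k) < i + 1 / real (Suc N)" "g (X n) < i + 1 / real (Suc N)"
      using X(2)[of k] X(2)[of n] that
      by (smt (verit) frac_le of_nat_0_less_iff of_nat_mono Suc_le_mono zero_less_Suc)+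
    ultimately show ?thesis by simp
  qed
  have "Cauchy X"
  proof (rule CauchyI)
    fix e :: real assume "e > 0"
    then obtain N where N: "1 / real (Suc N) < m / 4 * e\<^sup>2"
      using reals_Archimedean[of "m / 4 * e\<^sup>2"] m by (auto simp: inverse_eq_divide)
    have "norm (X k - X n) < e" if "N \<le> k" "N \<le> n" for k n
    proof -
      have "m / 4 * (norm (X k - X n))\<^sup>2 < m / 4 * e\<^sup>2" using close[OF that] N by linarith
      then have "(norm (X k - X n))\<^sup>2 < e\<^sup>2" using m by (simp add: mult_less_cancel_left)
      then show ?thesis using \<open>e > 0\<close> by (meson less_imp_le power_less_imp_less_base)
    qed
    then show "\<exists>M. \<forall>k\<ge>M. \<forall>n\<ge>M. norm (X k - X n) < e" by blast
  qed
  then obtain p where p: "X \<longlonglongrightarrow> p" using Cauchy_convergent convergent_def by blast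
  have pe: "p \<in> D \<and> g p \<le> i + e" if "e > 0" for e
  proof -
    obtain N where N: "1 / real (Suc N) < e"
      using reals_Archimedean[of e] \<open>e > 0\<close> by (auto simp: inverse_eq_divide)
    have "\<forall>\<^sub>F n in sequentially. X n \<in> {x \<in> D. g x \<le> i + e}"
      using eventually_ge_at_top[of N]
    proof eventually_elim
      case (elim n)
      then have "1 / real (Suc n) \<le> 1 / real (Suc N)" by (simp add: frac_le)
      then show ?case using X[of n] N by simp
    qed
    then have "p \<in> {x \<in> D. g x \<le> i + e}"
      using Lim_in_closed_set[OF closed _ _ p] by simp
    then show ?thesis by simp
  qed
  have pD: "p \<in> D" using pe[of 1] by simp
  have gp: "g p = i" using pe i_le[OF pD] field_le_epsilon[of "g p" i] by fastforce
  have "g p + m * (norm (x - p))\<^sup>2 \<le> g x" if x: "x \<in> D" for x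
  proof -
    \<comment> \<open>Compare \<open>p\<close> with the point at parameter \<open>t\<close> on the
      segment to \<open>x\<close> and divide by \<open>t\<close>; the limit \<open>t\<close> to 0
      then restores the full modulus \<open>m\<close>.\<close>
    have le: "g p + m * ((1 - t) * (norm (x - p))\<^sup>2) \<le> g x" if "0 < t" "t < 1" for t :: real
    proof -
      have "t * (g p + m * ((1 - t) * (norm (x - p))\<^sup>2)) \<le> t * g x"
        using i_le[OF dom[OF pD x that]] conv[OF pD x that] gp
        by (simp add: algebra_simps norm_minus_commute)
      then show ?thesis using \<open>0 < t\<close> by (simp add: mult_le_cancel_left)
    qed
    have lim: "((\<lambda>t. g p + m * ((1 - t) * (norm (x - p))\<^sup>2)) \<longlongrightarrow> g p + m * ((1 - 0) * (norm (x - p))\<^sup>2)) (at_right 0)"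
      by (intro tendsto_intros)
    show ?thesis
      using tendsto_upperbound[OF lim, of "g x"] le eventually_at_right_less[of 0]
      by (force simp: eventually_at_right_field intro: exI[of _ 1])
  qed
  with pD show ?thesis by blast
qed

text \<open>The squared distance to \<open>x\<close> is strongly convex with modulus 1; its growth
  at the minimizer is a Pythagorean inequality, equivalent to the obtuse angle property.\<close>

lemma convex_projection:
  fixes C :: "'a::{real_inner, complete_space} set"
  assumes "closed C" "convex C" "C \<noteq> {}"
  shows "\<exists>p\<in>C. \<forall>c\<in>C. (norm (p - x))\<^sup>2 + (norm (c - p))\<^sup>2 \<le> (norm (c - x))\<^sup>2"
proof -
  have conv: "(norm ((1 - t) *\<^sub>R a + t *\<^sub>R b - x))\<^sup>2 + 1 * (t * (1 - t) * (norm (a - b))\<^sup>2)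
    \<le> (1 - t) * (norm (a - x))\<^sup>2 + t * (norm (b - x))\<^sup>2" for a b t
    using norm_convex_combination[of t "a - x" "b - x"] by (simp add: algebra_simps)
  have cl: "closed {y \<in> C. (norm (y - x))\<^sup>2 \<le> c}" for c
    using \<open>closed C\<close> unfolding Collect_conj_eq Collect_mem_eq
    by (intro closed_Int closed_Collect_le continuous_intros)
  have dom: "(1 - t) *\<^sub>R a + t *\<^sub>R b \<in> C" if "a \<in> C" "b \<in> C" "0 < t" "t < 1" for a b t
    using \<open>convex C\<close> that by (auto simp: convex_alt)
  show ?thesis
    using strongly_convex_minimizer[where g = "\<lambda>c. (norm (c - x))\<^sup>2",
        OF \<open>C \<noteq> {}\<close> zero_le_power2 zero_less_one dom conv cl]
    by simp
qed

section \<open>Weak convergence\<close>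

lemma convex_sublevel:
  assumes "convex_on UNIV F"
  shows "convex {x. F x \<le> (c::real)}"
  unfolding convex_alt
proof clarsimp
  fix x y and t :: real
  assume *: "F x \<le> c" "F y \<le> c" "0 \<le> t" "t \<le> 1"
  have "F ((1 - t) *\<^sub>R x + t *\<^sub>R y) \<le> (1 - t) * F x + t * F y"
    using convex_onD[OF assms, of t x y] * by simp
  also have "\<dots> \<le> (1 - t) * c + t * c" using * by (intro add_mono mult_left_mono) auto
  finally show "F ((1 - t) *\<^sub>R x + t *\<^sub>R y) \<le> c" by (simp add: algebra_simps)
qed

text \<open>$P$ is the limit of the projections of $x$ onto the sublevel sets of $F$ at $1/n$, each of which
  eventually contains $y$.\<close>

lemma dist_convex_limit:
  fixes F :: "'a::{real_inner, complete_space} \<Rightarrow> real"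
  assumes cvx: "convex_on UNIV F" and cont: "continuous_on UNIV F" and nonneg: "\<And>x. 0 \<le> F x"
    and z: "F z = 0" and y: "((\<lambda>t. F (y t)) \<longlongrightarrow> 0) at_top"
  shows "\<exists>P. F P = 0 \<and> (\<forall>e>0. \<forall>\<^sub>F t in at_top. norm (y t - P) \<le> norm (y t - x) + e)"
proof -
  define C where "C n = {w. F w \<le> 1 / real (Suc n)}" for n
  have C: "closed (C n)" "convex (C n)" "z \<in> C n" for n
    using cont cvx z unfolding C_def
    by (auto intro!: closed_Collect_le continuous_intros dest: convex_sublevel)
  have "\<exists>p\<in>C n. \<forall>c\<in>C n. (norm (p - x))\<^sup>2 + (norm (c - p))\<^sup>2 \<le> (norm (c - x))\<^sup>2" for n
    using C by (intro convex_projection) auto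
  then obtain X where X: "\<And>n. X n \<in> C n"
    "\<And>n c. c \<in> C n \<Longrightarrow> (norm (X n - x))\<^sup>2 + (norm (c - X n))\<^sup>2 \<le> (norm (c - x))\<^sup>2" by metis
  have C_mono: "C n \<subseteq> C k" if "k \<le> n" for k n
  proof -
    have "1 / real (Suc n) \<le> 1 / real (Suc k)" using that by (simp add: frac_le)
    then show ?thesis unfolding C_def by auto
  qed
  define d where "d n = (norm (X n - x))\<^sup>2" for n
  \<comment> \<open>The sets \<open>C n\<close> decrease, so \<open>X n\<close> is a competitor for
    the projection onto \<open>C k\<close>. Thus \<open>d\<close> increases, and its increments
    control the distances between the projections.\<close>
  have step: "d k + (norm (X n - X k))\<^sup>2 \<le> d n" if "k \<le> n" for k n
    using X(2)[of "X n" k] C_mono[OF that] X(1)[of n] by (auto simp: d_def)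
  have "incseq d"
    unfolding incseq_def using step by (smt (verit) zero_le_power2)
  moreover have "d n \<le> (norm (z - x))\<^sup>2" for n
    using X(2)[OF C(3)[of n]] unfolding d_def by (smt (verit) zero_le_power2)
  ultimately have "Cauchy d"
    by (metis incseq_convergent convergent_Cauchy convergent_def)
  have "Cauchy X"
  proof (rule CauchyI)
    fix e :: real assume "e > 0"
    obtain M where M: "\<And>m n. M \<le> m \<Longrightarrow> M \<le> n \<Longrightarrow> \<bar>d m - d n\<bar> < e\<^sup>2"
      using CauchyD[OF \<open>Cauchy d\<close>, of "e\<^sup>2"] \<open>e > 0\<close> by auto
    have *: "norm (X n - X k) < e" if "M \<le> k" "k \<le> n" for k n
      using step[OF \<open>k \<le> n\<close>] M[of n k] that \<open>e > 0\<close>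
      by (intro power_less_imp_less_base[of _ 2 e]) auto
    have "norm (X m - X n) < e" if "M \<le> m" "M \<le> n" for m n
      using *[of m n] *[of n m] that by (cases "m \<le> n") (auto simp: norm_minus_commute)
    then show "\<exists>M. \<forall>m\<ge>M. \<forall>n\<ge>M. norm (X m - X n) < e" by blast
  qed
  then obtain P where P: "X \<longlonglongrightarrow> P" using Cauchy_convergent convergent_def by blast
  have "(\<lambda>n. F (X n)) \<longlonglongrightarrow> F P"
    using cont P continuous_on_tendsto_compose[of UNIV F X P] by auto
  moreover have "(\<lambda>n. 1 / real (Suc n)) \<longlonglongrightarrow> 0" by (rule LIMSEQ_Suc[OF lim_1_over_n])
  ultimately have "F P \<le> 0"
    using X(1) unfolding C_def by (intro LIMSEQ_le) auto
  then have FP: "F P = 0" using nonneg[of P] by simp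
  have "\<forall>\<^sub>F t in at_top. norm (y t - P) \<le> norm (y t - x) + e" if "e > 0" for e
  proof -
    obtain n where n: "norm (X n - P) < e"
      using LIMSEQ_D[OF P \<open>e > 0\<close>] by blast
    have "\<forall>\<^sub>F t in at_top. F (y t) < 1 / real (Suc n)"
      using order_tendstoD(2)[OF y] by simp
    then show ?thesis
    proof eventually_elim
      case (elim t)
      then have "(norm (X n - x))\<^sup>2 + (norm (y t - X n))\<^sup>2 \<le> (norm (y t - x))\<^sup>2"
        by (intro X(2)) (simp add: C_def)
      then have "(norm (y t - X n))\<^sup>2 \<le> (norm (y t - x))\<^sup>2" by (smt (verit) zero_le_power2)
      then have "norm (y t - X n) \<le> norm (y t - x)" by (simp add: power2_le_iff_abs_le)
      then show ?case using n norm_triangle_ineq[of "y t - X n" "X n - P"] by simp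
    qed
  qed
  with FP show ?thesis by blast
qed

text \<open>Instead of weak compactness, the weak limit is found as the minimizer $p$ of $r(z) = \lim |y - z|$
  over the zero set of $F$. By the preceding lemma $|y - x| \ge r(p) - \epsilon$ eventually, for every
  point $x$ of the space; expanding the square for $x = p + s w$ bounds $\langle y - p, w\rangle$ from above.\<close>

lemma opial_convex:
  fixes F :: "'a::{real_inner, complete_space} \<Rightarrow> real"
  assumes cvx: "convex_on UNIV F" and cont: "continuous_on UNIV F" and nonneg: "\<And>x. 0 \<le> F x"
    and z: "F z = 0" and y: "((\<lambda>t. F (y t)) \<longlongrightarrow> 0) at_top"
    and lim: "\<And>z. F z = 0 \<Longrightarrow> \<exists>l. ((\<lambda>t. norm (y t - z)) \<longlongrightarrow> l) at_top"
  shows "\<exists>p. F p = 0 \<and> weak_conv_at_top y p"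
proof -
  define S where "S = {z. F z = 0}"
  have S_eq: "S = {z. F z \<le> 0}" using nonneg by (auto simp: S_def intro: antisym)
  have S: "closed S" "convex S" "z \<in> S"
    using cont cvx z unfolding S_eq
    by (auto intro!: closed_Collect_le continuous_intros dest: convex_sublevel)
  obtain r where r: "\<And>z. z \<in> S \<Longrightarrow> ((\<lambda>t. norm (y t - z)) \<longlongrightarrow> r z) at_top"
    using bchoice[of S "\<lambda>z l. ((\<lambda>t. norm (y t - z)) \<longlongrightarrow> l) at_top"] lim
    unfolding S_def by blast
  have r0: "0 \<le> r z" if "z \<in> S" for z
    by (rule tendsto_lowerbound[OF r[OF that]]) auto
  \<comment> \<open>The Lipschitz bound gives the closed sublevel sets required for minimizing
    \<open>r\<close> squared over \<open>S\<close>.\<close>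
  have rlip: "\<bar>r a - r b\<bar> \<le> norm (a - b)" if "a \<in> S" "b \<in> S" for a b
  proof (rule tendsto_upperbound)
    show "((\<lambda>t. \<bar>norm (y t - a) - norm (y t - b)\<bar>) \<longlongrightarrow> \<bar>r a - r b\<bar>) at_top"
      by (intro tendsto_intros r that)
    show "\<forall>\<^sub>F t in at_top. \<bar>norm (y t - a) - norm (y t - b)\<bar> \<le> norm (a - b)"
    proof (intro always_eventually allI)
      fix t
      show "\<bar>norm (y t - a) - norm (y t - b)\<bar> \<le> norm (a - b)"
        using norm_triangle_ineq3[of "y t - a" "y t - b"] by (simp add: norm_minus_commute)
    qed
  qed simp
  have dom: "(1 - t) *\<^sub>R a + t *\<^sub>R b \<in> S" if "a \<in> S" "b \<in> S" "0 < t" "t < 1" for a b t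
    using \<open>convex S\<close> that by (auto simp: convex_alt)
  \<comment> \<open>The identity for squared norms survives the limit, so \<open>r\<close> squared
    is strongly convex on \<open>S\<close> with modulus 1.\<close>
  have rconv: "(r ((1 - t) *\<^sub>R a + t *\<^sub>R b))\<^sup>2 + 1 * (t * (1 - t) * (norm (a - b))\<^sup>2)
      = (1 - t) * (r a)\<^sup>2 + t * (r b)\<^sup>2" if "a \<in> S" "b \<in> S" "0 < t" "t < 1" for a b t
  proof (rule tendsto_unique)
    let ?c = "(1 - t) *\<^sub>R a + t *\<^sub>R b"
    let ?h = "\<lambda>s. (norm (y s - ?c))\<^sup>2 + 1 * (t * (1 - t) * (norm (a - b))\<^sup>2)"
    show "(?h \<longlongrightarrow> (r ?c)\<^sup>2 + 1 * (t * (1 - t) * (norm (a - b))\<^sup>2)) at_top"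
      by (intro tendsto_intros r dom that)
    have "?h = (\<lambda>s. (1 - t) * (norm (y s - a))\<^sup>2 + t * (norm (y s - b))\<^sup>2)"
    proof
      fix s show "?h s = (1 - t) * (norm (y s - a))\<^sup>2 + t * (norm (y s - b))\<^sup>2"
        using norm_convex_combination[of t "y s - a" "y s - b"]
        by (simp add: algebra_simps norm_minus_commute)
    qed
    then show "(?h \<longlongrightarrow> (1 - t) * (r a)\<^sup>2 + t * (r b)\<^sup>2) at_top"
      by (simp only:) (intro tendsto_intros r that)
  qed simp
  have rcl: "closed {z \<in> S. (r z)\<^sup>2 \<le> c}" for c
  proof -
    have "continuous_on S r"
      by (rule lipschitz_on_continuous_on[of 1], rule lipschitz_onI)
        (use rlip in \<open>auto simp: dist_norm\<close>)
    then have "closed (S \<inter> (\<lambda>z. (r z)\<^sup>2) -` {..c})"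
      by (intro continuous_closed_preimage continuous_intros S) auto
    then show ?thesis by (simp add: Int_def vimage_def)
  qed
  have ne: "S \<noteq> {}" using S by blast
  obtain p where p: "p \<in> S" and pmin: "\<And>x. x \<in> S \<Longrightarrow> (r p)\<^sup>2 + 1 * (norm (x - p))\<^sup>2 \<le> (r x)\<^sup>2"
    using strongly_convex_minimizer[where g = "\<lambda>z. (r z)\<^sup>2", OF ne zero_le_power2 zero_less_one dom eq_refl[OF rconv] rcl] by blast
  have ge: "\<forall>\<^sub>F t in at_top. r p - e < norm (y t - x)" if "e > 0" for x e
  proof -
    obtain P where P: "P \<in> S" "\<forall>\<^sub>F t in at_top. norm (y t - P) \<le> norm (y t - x) + e / 2"
      using dist_convex_limit[OF cvx cont nonneg z y, of x] half_gt_zero[OF \<open>e > 0\<close>]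
      unfolding S_def by blast
    have "(r p)\<^sup>2 \<le> (r P)\<^sup>2" using pmin[OF P(1)] by (smt (verit) zero_le_power2)
    then have "r p \<le> r P" using r0 p P by (simp add: power2_le_iff_abs_le)
    then have "\<forall>\<^sub>F t in at_top. r p - e / 2 < norm (y t - P)"
      using order_tendstoD(1)[OF r[OF P(1)], of "r p - e / 2"] \<open>e > 0\<close> by simp
    with P(2) show ?thesis by eventually_elim simp
  qed
  have sq: "\<forall>\<^sub>F t in at_top. (r p)\<^sup>2 - e < (norm (y t - x))\<^sup>2" if "e > 0" for x e
  proof (cases "r p = 0")
    case True
    then show ?thesis using \<open>e > 0\<close> by (simp add: less_le_trans[OF _ zero_le_power2])
  next
    case False
    then have rp: "r p > 0" using r0[OF p] by simp
    \<comment> \<open>Chosen so that \<open>r p - d\<close> stays nonnegative and squaring it loses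
      at most \<open>2 * r p * d\<close>, hence at most \<open>e\<close>.\<close>
    define d where "d = min (r p) (e / (2 * r p))"
    have d: "d > 0" "d \<le> r p" "2 * r p * d \<le> e"
      using rp \<open>e > 0\<close> by (auto simp: d_def min_def field_simps)
    show ?thesis using ge[OF d(1), of x]
    proof eventually_elim
      case (elim t)
      then have "(r p - d)\<^sup>2 < (norm (y t - x))\<^sup>2" using d by (intro power_strict_mono) auto
      then show ?case using d by (simp add: power2_diff algebra_simps) (smt (verit) zero_le_power2)
    qed
  qed
  have upper: "\<forall>\<^sub>F t in at_top. (y t - p) \<bullet> w < e" if "e > 0" for w e
  proof -
    \<comment> \<open>With this step length the quadratic term of the expansion is at most
      \<open>s * e\<close>; the two errors \<open>s * e / 2\<close> add up to another
      \<open>s * e\<close>, and dividing by \<open>2 * s\<close> leaves \<open>e\<close>.\<close>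
    define s where "s = e / ((norm w)\<^sup>2 + 1)"
    have pos: "(norm w)\<^sup>2 + 1 > 0" by (smt (verit) zero_le_power2)
    then have s: "s > 0" "s * (norm w)\<^sup>2 \<le> e" using \<open>e > 0\<close> by (auto simp: s_def field_simps)
    have "\<forall>\<^sub>F t in at_top. (norm (y t - p))\<^sup>2 < (r p)\<^sup>2 + s * e / 2"
      using order_tendstoD(2)[OF tendsto_power[OF r[OF p], of 2], of "(r p)\<^sup>2 + s * e / 2"] s \<open>e > 0\<close>
      by simp
    moreover have "\<forall>\<^sub>F t in at_top. (r p)\<^sup>2 - s * e / 2 < (norm (y t - (p + s *\<^sub>R w)))\<^sup>2"
      by (rule sq) (use s \<open>e > 0\<close> in simp)
    ultimately show ?thesis
    proof eventually_elim
      case (elim t)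
      have "(norm (y t - (p + s *\<^sub>R w)))\<^sup>2
          = (norm (y t - p))\<^sup>2 - 2 * s * ((y t - p) \<bullet> w) + s * (s * (norm w)\<^sup>2)"
        unfolding power2_norm_eq_inner by (simp add: inner_commute algebra_simps)
      moreover have "s * (s * (norm w)\<^sup>2) \<le> s * e" using s by simp
      ultimately have "2 * s * ((y t - p) \<bullet> w) < 2 * s * e" using elim by simp
      then show ?case using s by simp
    qed
  qed
  have "weak_conv_at_top y p"
    unfolding weak_conv_at_top_def
  proof (intro allI tendstoI)
    fix w and e :: real assume "e > 0"
    show "\<forall>\<^sub>F t in at_top. dist (y t \<bullet> w) (p \<bullet> w) < e"
      using upper[OF \<open>e > 0\<close>, of w] upper[OF \<open>e > 0\<close>, of "- w"]
      by eventually_elim (simp add: dist_real_def inner_diff_left abs_less_iff)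
  qed
  with p show ?thesis by (auto simp: S_def)
qed

section \<open>Moreau envelope and proximal mapping\<close>

lemma grad_eqI:
  assumes "(F has_derivative (\<lambda>h. g \<bullet> h)) (at x)"
  shows "grad F x = g"
  unfolding grad_def
proof (rule the_equality)
  fix g' assume "(F has_derivative (\<lambda>h. g' \<bullet> h)) (at x)"
  then have "(\<lambda>h. g' \<bullet> h) = (\<lambda>h. g \<bullet> h)" using assms by (rule has_derivative_unique)
  then have "(g' - g) \<bullet> (g' - g) = 0" by (metis inner_diff_left diff_self)
  then show "g' = g" by simp
qed fact

text \<open>Differentiability of the envelope can then be read off from two inequalities, without
  differentiating the proximal mapping.\<close>

lemma has_derivative_of_quadratic_bound:
  fixes F :: "'a::real_inner \<Rightarrow> real"
  assumes "\<And>y. \<bar>F y - F x - g \<bullet> (y - x)\<bar> \<le> K * (norm (y - x))\<^sup>2"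
  shows "(F has_derivative (\<lambda>h. g \<bullet> h)) (at x)"
  unfolding has_derivative_at
proof
  show "bounded_linear (\<lambda>h. g \<bullet> h)" by (rule bounded_linear_inner_right)
  have "((\<lambda>h. K * norm h) \<longlongrightarrow> K * 0) (at (0::'a))"
    by (rule tendsto_mult[OF tendsto_const tendsto_norm_zero[OF tendsto_ident_at]])
  then have "((\<lambda>h. K * norm h) \<longlongrightarrow> 0) (at (0::'a))" by simp
  moreover have "norm (norm (F (x + h) - F x - g \<bullet> h) / norm h) \<le> K * norm h" if "h \<noteq> 0" for h
    using assms[of "x + h"] that by (simp add: divide_le_eq power2_eq_square)
  ultimately show "(\<lambda>h. norm (F (x + h) - F x - g \<bullet> h) / norm h) \<midarrow>0\<rightarrow> 0"
    using Lim_null_comparison[of "\<lambda>h. norm (F (x + h) - F x - g \<bullet> h) / norm h" "\<lambda>h. K * norm h" "at 0"]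
    by (simp add: eventually_at_filter)
qed

locale convex_lsc =
  fixes f :: "'a::{real_inner, complete_space} \<Rightarrow> ereal" and lam :: real
  assumes conv: "convex_ext f" and lsc: "lsc_ext f" and proper: "proper_fun f"
    and argmin_ne: "argmin_set f \<noteq> {}" and lam: "lam > 0"
begin

text \<open>The conversion \<open>real_of_ereal\<close> sends infinity to 0, so \<open>fr\<close> is
  informative only on \<open>edom\<close> and is used at points of that set.\<close>

definition "edom = {x. f x \<noteq> \<infinity>}"
definition "fr x = real_of_ereal (f x)"
definition "minval = real_of_ereal (Inf (range f))"

lemma f_eq: "x \<in> edom \<Longrightarrow> f x = ereal (fr x)"
  using proper unfolding edom_def fr_def proper_fun_def by (cases "f x") auto

text \<open>The infimum is attained, and at a finite value since \<open>f\<close> is finite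
  somewhere; hence converting it to the real number \<open>minval\<close> loses nothing.\<close>

lemma argmin_eq: "z \<in> argmin_set f \<longleftrightarrow> z \<in> edom \<and> fr z = minval"
  and minval_le: "x \<in> edom \<Longrightarrow> minval \<le> fr x"
proof -
  obtain w where w: "w \<in> argmin_set f" using argmin_ne by blast
  obtain v where "f v \<noteq> \<infinity>" using proper unfolding proper_fun_def by blast
  have edom: "a \<in> edom" if "a \<in> argmin_set f" for a
    using that \<open>f v \<noteq> \<infinity>\<close> unfolding argmin_set_def edom_def
    by (metis (mono_tags) ereal_infty_less_eq(1) mem_Collect_eq)
  have Inf: "Inf (range f) = f a" if "a \<in> argmin_set f" for a
    using that unfolding argmin_set_def by (intro antisym Inf_lower Inf_greatest) auto
  then have val: "minval = fr a" if "a \<in> argmin_set f" for a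
    using that by (simp add: minval_def fr_def)
  show le: "minval \<le> fr x" if "x \<in> edom" for x
    using w f_eq[OF that] f_eq[OF edom[OF w]] val[OF w] unfolding argmin_set_def
    by (metis (mono_tags) ereal_less_eq(3) mem_Collect_eq)
  show "z \<in> argmin_set f \<longleftrightarrow> z \<in> edom \<and> fr z = minval"
  proof
    assume "z \<in> edom \<and> fr z = minval"
    then have "f z = f w" using f_eq edom val w by metis
    with w show "z \<in> argmin_set f" by (simp add: argmin_set_def)
  qed (use edom val in auto)
qed

lemma dom_convex:
  assumes "x \<in> edom" "y \<in> edom" "0 < t" "t < 1"
  shows "(1 - t) *\<^sub>R x + t *\<^sub>R y \<in> edom"
    and "fr ((1 - t) *\<^sub>R x + t *\<^sub>R y) \<le> (1 - t) * fr x + t * fr y"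
proof -
  have le: "f ((1 - t) *\<^sub>R x + t *\<^sub>R y) \<le> ereal ((1 - t) * fr x + t * fr y)"
    using conv[unfolded convex_ext_def, rule_format, of t x y] assms by (simp add: f_eq)
  then show d: "(1 - t) *\<^sub>R x + t *\<^sub>R y \<in> edom" unfolding edom_def by auto
  show "fr ((1 - t) *\<^sub>R x + t *\<^sub>R y) \<le> (1 - t) * fr x + t * fr y"
    using le f_eq[OF d] by simp
qed

lemma fr_sublevel: "{x \<in> edom. fr x \<le> c} = {x. f x \<le> ereal c}"
proof -
  have "f x \<le> ereal c \<longleftrightarrow> x \<in> edom \<and> fr x \<le> c" for x
  proof (cases "x \<in> edom")
    case True
    then show ?thesis by (simp add: f_eq)
  qed (simp add: edom_def)
  then show ?thesis by simp
qed

text \<open>Along a convergent sequence the continuous part is eventually above its limit minus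
  \<open>e\<close>, which places the limit point in a closed sublevel set of \<open>f\<close> alone;
  then \<open>e\<close> is removed.\<close>

lemma closed_sublevel_add:
  assumes "continuous_on UNIV q"
  shows "closed {x \<in> edom. fr x + q x \<le> c}"
  unfolding closed_sequential_limits
proof (intro allI impI)
  fix X l assume "(\<forall>n. X n \<in> {x \<in> edom. fr x + q x \<le> c}) \<and> X \<longlonglongrightarrow> l"
  then have X: "\<And>n. X n \<in> edom" "\<And>n. fr (X n) + q (X n) \<le> c" and l: "X \<longlonglongrightarrow> l" by auto
  have lim: "(\<lambda>n. q (X n)) \<longlonglongrightarrow> q l"
    using assms l continuous_on_tendsto_compose[of UNIV q X l] by auto
  have le: "l \<in> edom \<and> fr l \<le> c - q l + e" if "e > 0" for e
  proof -
    have "\<forall>\<^sub>F n in sequentially. q l - e < q (X n)"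
      using order_tendstoD(1)[OF lim] \<open>e > 0\<close> by simp
    then have "\<forall>\<^sub>F n in sequentially. X n \<in> {x \<in> edom. fr x \<le> c - q l + e}"
    proof eventually_elim
      case (elim n)
      then show ?case using X[of n] by simp
    qed
    moreover have "closed {x \<in> edom. fr x \<le> c - q l + e}"
      using lsc unfolding fr_sublevel lsc_ext_def by blast
    ultimately have "l \<in> {x \<in> edom. fr x \<le> c - q l + e}"
      using Lim_in_closed_set[OF _ _ trivial_limit_sequentially l] by blast
    then show ?thesis by simp
  qed
  then have "fr l \<le> c - q l" using field_le_epsilon by blast
  with le[of 1] show "l \<in> {x \<in> edom. fr x + q x \<le> c}" by simp
qed

text \<open>The squared distance divided by \<open>2 * lam\<close> contributes the modulus
  \<open>1 / (2 * lam)\<close>, and convexity of \<open>f\<close> preserves it.\<close>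

lemma prox_exists:
  "\<exists>p\<in>edom. \<forall>y\<in>edom. fr p + (norm (x - p))\<^sup>2 / (2 * lam) + 1 / (2 * lam) * (norm (y - p))\<^sup>2
      \<le> fr y + (norm (x - y))\<^sup>2 / (2 * lam)"
proof (rule strongly_convex_minimizer)
  show "edom \<noteq> {}" using proper unfolding edom_def proper_fun_def by blast
  show "minval \<le> fr y + (norm (x - y))\<^sup>2 / (2 * lam)" if "y \<in> edom" for y
    using minval_le[OF that] lam by (simp add: add_increasing2)
  show "1 / (2 * lam) > 0" using lam by simp
  show "closed {y \<in> edom. fr y + (norm (x - y))\<^sup>2 / (2 * lam) \<le> c}" for c
    using lam by (intro closed_sublevel_add continuous_intros) auto
  fix a b and t :: real assume *: "a \<in> edom" "b \<in> edom" "0 < t" "t < 1"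
  show "(1 - t) *\<^sub>R a + t *\<^sub>R b \<in> edom" by (rule dom_convex[OF *])
  have "(norm (x - ((1 - t) *\<^sub>R a + t *\<^sub>R b)))\<^sup>2 + t * (1 - t) * (norm (a - b))\<^sup>2
      = (1 - t) * (norm (x - a))\<^sup>2 + t * (norm (x - b))\<^sup>2"
    using norm_convex_combination[of t "x - a" "x - b"]
    by (simp add: algebra_simps norm_minus_commute)
  then have "(norm (x - ((1 - t) *\<^sub>R a + t *\<^sub>R b)))\<^sup>2 / (2 * lam) + 1 / (2 * lam) * (t * (1 - t) * (norm (a - b))\<^sup>2)
      = (1 - t) * ((norm (x - a))\<^sup>2 / (2 * lam)) + t * ((norm (x - b))\<^sup>2 / (2 * lam))"
    using lam by (simp add: field_simps)
  with dom_convex(2)[OF *]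
  show "fr ((1 - t) *\<^sub>R a + t *\<^sub>R b) + (norm (x - ((1 - t) *\<^sub>R a + t *\<^sub>R b)))\<^sup>2 / (2 * lam)
      + 1 / (2 * lam) * (t * (1 - t) * (norm (a - b))\<^sup>2)
    \<le> (1 - t) * (fr a + (norm (x - a))\<^sup>2 / (2 * lam)) + t * (fr b + (norm (x - b))\<^sup>2 / (2 * lam))"
    unfolding distrib_left by linarith
qed

abbreviation "P \<equiv> prox f lam"

text \<open>Quadratic growth around the minimizer makes it unique, so the definite description in
  \<open>prox\<close> denotes it. The growth term is retained in \<open>prox_le\<close> because the
  gradient inequalities depend on it.\<close>

lemma prox_dom: "P x \<in> edom"
  and prox_le: "y \<in> edom \<Longrightarrow> fr (P x) + (norm (x - P x))\<^sup>2 / (2 * lam) + (norm (y - P x))\<^sup>2 / (2 * lam)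
      \<le> fr y + (norm (x - y))\<^sup>2 / (2 * lam)"
  and moreau_env_eq: "moreau_env f lam x = fr (P x) + (norm (x - P x))\<^sup>2 / (2 * lam)"
proof -
  let ?q = "\<lambda>y. (norm (x - y))\<^sup>2 / (2 * lam)"
  obtain p where p: "p \<in> edom"
    "\<And>y. y \<in> edom \<Longrightarrow> fr p + ?q p + 1 / (2 * lam) * (norm (y - p))\<^sup>2 \<le> fr y + ?q y"
    using prox_exists[of x] by blast
  have fin: "f p + ereal (?q p) \<le> f y + ereal (?q y)" for y
  proof (cases "y \<in> edom")
    case True
    have "0 \<le> 1 / (2 * lam) * (norm (y - p))\<^sup>2" using lam by simp
    with p(2)[OF True] show ?thesis using f_eq[OF True] f_eq[OF p(1)] by simp
  qed (simp add: edom_def)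
  have "P x = p"
    unfolding prox_def
  proof (rule the_equality)
    fix r assume r: "\<forall>y. f r + ereal (?q r) \<le> f y + ereal (?q y)"
    then have "f r + ereal (?q r) \<le> f p + ereal (?q p)" by blast
    then have rd: "r \<in> edom" using f_eq[OF p(1)] by (auto simp: edom_def)
    have "fr r + ?q r \<le> fr p + ?q p" using r f_eq[OF p(1)] f_eq[OF rd] by (metis ereal_less_eq(3) plus_ereal.simps(1))
    then have "1 / (2 * lam) * (norm (r - p))\<^sup>2 \<le> 0" using p(2)[OF rd] by linarith
    then show "r = p" using lam by (simp add: divide_le_0_iff)
  qed (use fin in blast)
  then show "P x \<in> edom" "y \<in> edom \<Longrightarrow> fr (P x) + ?q (P x) + (norm (y - P x))\<^sup>2 / (2 * lam) \<le> fr y + ?q y"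
    using p by auto
  have "(INF y. f y + ereal (?q y)) = f p + ereal (?q p)"
    using fin by (intro antisym INF_lower INF_greatest) auto
  then show "moreau_env f lam x = fr (P x) + ?q (P x)"
    using f_eq[OF p(1)] \<open>P x = p\<close> by (simp add: moreau_env_def)
qed

section \<open>The normalized envelope as a differentiable convex function\<close>

definition "env x = moreau_env f lam x - minval"
text \<open>This is the Yosida approximation of the subdifferential of \<open>f\<close>.\<close>

definition "env_grad x = (1 / lam) *\<^sub>R (x - P x)"

text \<open>Test the minimality of \<open>P x\<close> with the competitor \<open>P y\<close>. What
  remains after removing the linear term is the square of \<open>y - x - (P y - P x)\<close> over
  \<open>2 * lam\<close>, which is nonnegative.\<close>

lemma env_subgradient: "env x + env_grad x \<bullet> (y - x) \<le> env y"
proof -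
  have "(norm (y - P y))\<^sup>2 + (norm (P y - P x))\<^sup>2 - (norm (x - P y))\<^sup>2 - 2 * ((x - P x) \<bullet> (y - x))
      = (norm (y - x - (P y - P x)))\<^sup>2"
    unfolding power2_norm_eq_inner by (simp add: inner_commute algebra_simps)
  then have "2 * ((x - P x) \<bullet> (y - x)) \<le> (norm (y - P y))\<^sup>2 + (norm (P y - P x))\<^sup>2 - (norm (x - P y))\<^sup>2"
    by (smt (verit) zero_le_power2)
  then have "2 * ((x - P x) \<bullet> (y - x)) / (2 * lam)
      \<le> ((norm (y - P y))\<^sup>2 + (norm (P y - P x))\<^sup>2 - (norm (x - P y))\<^sup>2) / (2 * lam)"
    using lam by (intro divide_right_mono) auto
  then show ?thesis
    using prox_le[OF prox_dom[of y], of x]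
    by (simp add: env_def env_grad_def moreau_env_eq add_divide_distrib diff_divide_distrib)
qed

text \<open>Here \<open>P x\<close> is the competitor in the problem defining \<open>P y\<close>,
  and the square is expanded around \<open>x\<close>.\<close>

lemma env_quadratic_upper: "env y \<le> env x + env_grad x \<bullet> (y - x) + 1 / (2 * lam) * (norm (y - x))\<^sup>2"
proof -
  have "(norm (y - P x))\<^sup>2 = (norm (x - P x))\<^sup>2 + 2 * ((x - P x) \<bullet> (y - x)) + (norm (y - x))\<^sup>2"
    unfolding power2_norm_eq_inner by (simp add: inner_commute algebra_simps)
  moreover have "(norm (P x - P y))\<^sup>2 / (2 * lam) \<ge> 0" using lam by simp
  ultimately show ?thesis
    using prox_le[OF prox_dom[of x], of y]
    by (simp add: env_def env_grad_def moreau_env_eq add_divide_distrib diff_divide_distrib)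
qed

lemma env_has_derivative: "(env has_derivative (\<lambda>h. env_grad x \<bullet> h)) (at x)"
proof (rule has_derivative_of_quadratic_bound[of _ _ _ "1 / (2 * lam)"])
  show "\<bar>env y - env x - env_grad x \<bullet> (y - x)\<bar> \<le> 1 / (2 * lam) * (norm (y - x))\<^sup>2" for y
    using env_subgradient[of x y] env_quadratic_upper[of y x] by linarith
qed

lemma grad_moreau_env: "grad (moreau_env f lam) x = env_grad x"
proof (rule grad_eqI)
  have "((\<lambda>x. env x + minval) has_derivative (\<lambda>h. env_grad x \<bullet> h)) (at x)"
    using has_derivative_add[OF env_has_derivative has_derivative_const] by simp
  then show "(moreau_env f lam has_derivative (\<lambda>h. env_grad x \<bullet> h)) (at x)"
    by (simp add: env_def)
qed

lemma prox_value_nonneg: "0 \<le> fr (P x) - minval"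
  using minval_le[OF prox_dom] by simp

lemma prox_value_le: "fr (P x) - minval \<le> env x"
  using lam by (simp add: env_def moreau_env_eq)

text \<open>The envelope gap is the value gap at \<open>P x\<close> plus a multiple of the squared
  distance from \<open>x\<close> to \<open>P x\<close>; both are nonnegative, so both vanish and
  \<open>x = P x\<close>. Conversely a minimizer is its own competitor.\<close>

lemma env_eq_0_iff: "env x = 0 \<longleftrightarrow> x \<in> argmin_set f"
proof
  assume env: "env x = 0"
  have "0 \<le> (norm (x - P x))\<^sup>2 / (2 * lam)" using lam by simp
  then have "fr (P x) = minval" "(norm (x - P x))\<^sup>2 / (2 * lam) = 0"
    using env prox_value_nonneg[of x] unfolding env_def moreau_env_eq by linarith+
  then show "x \<in> argmin_set f" using lam prox_dom[of x] argmin_eq[of x] by simp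
next
  assume "x \<in> argmin_set f"
  then have x: "x \<in> edom" "fr x = minval" using argmin_eq by auto
  have "0 \<le> (norm (x - P x))\<^sup>2 / (2 * lam)" using lam by simp
  then have "env x \<le> 0" using prox_le[OF x(1), of x] x(2)
    by (simp add: env_def moreau_env_eq norm_minus_commute)
  then show "env x = 0" using prox_value_nonneg prox_value_le by (meson antisym order_trans)
qed

end

section \<open>The inertial flow\<close>

lemma nonincreasing_on_ray:
  fixes h :: "real \<Rightarrow> real"
  assumes "\<And>t. t > T \<Longrightarrow> (h has_real_derivative h' t) (at t)" "\<And>t. t > T \<Longrightarrow> h' t \<le> 0"
    and "T < s" "s \<le> t"
  shows "h t \<le> h s"
proof (rule DERIV_nonpos_imp_nonincreasing[OF \<open>s \<le> t\<close>])
  fix x assume "s \<le> x"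
  then show "\<exists>y. (h has_real_derivative y) (at x) \<and> y \<le> 0"
    using assms(1,2)[of x] \<open>T < s\<close> by auto
qed

lemma nonincreasing_tendsto_at_top:
  fixes h :: "real \<Rightarrow> real"
  assumes mono: "\<And>s t. T < s \<Longrightarrow> s \<le> t \<Longrightarrow> h t \<le> h s" and bdd: "\<And>t. t > T \<Longrightarrow> b \<le> h t"
  shows "\<exists>l. (h \<longlongrightarrow> l) at_top"
proof
  have bb: "bdd_below (h ` {T<..})" using bdd by (auto simp: bdd_below_def)
  show "(h \<longlongrightarrow> Inf (h ` {T<..})) at_top"
  proof (rule order_tendstoI)
    fix a assume "a < Inf (h ` {T<..})"
    then have gt: "a < h t" if "t > T" for t
      using cINF_lower[OF bb, of t] that by simp
    show "\<forall>\<^sub>F t in at_top. a < h t"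
      by (rule eventually_mono[OF eventually_gt_at_top gt])
  next
    fix a assume "Inf (h ` {T<..}) < a"
    then obtain s where s: "s > T" "h s < a"
      using cInf_lessD[of "h ` {T<..}" a] by auto
    then have lt: "h t < a" if "t \<ge> s" for t using mono[OF s(1) that] by simp
    show "\<forall>\<^sub>F t in at_top. h t < a"
      by (rule eventually_mono[OF eventually_ge_at_top lt])
  qed
qed

text \<open>The function \<open>t ^ n * (h t - c)\<close> has derivative
  \<open>n * t ^ (n - 1)\<close> times the excess of \<open>h + t / n * h'\<close> over
  \<open>c\<close>, so it is nonincreasing. Hence \<open>h\<close> exceeds \<open>c\<close> by at
  most a constant over \<open>t ^ n\<close>, which the gap between \<open>c\<close> and
  \<open>d\<close> absorbs.\<close>

lemma weighted_average_less:
  fixes h :: "real \<Rightarrow> real"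
  assumes n: "n > 0" and T: "T \<ge> 0"
    and der: "\<And>t. t > T \<Longrightarrow> (h has_real_derivative h' t) (at t)"
    and le: "\<And>t. t > T \<Longrightarrow> h t + t / real n * h' t \<le> c" and "c < d"
  shows "\<forall>\<^sub>F t in at_top. h t < d"
proof -
  define K where "K t = t ^ n * (h t - c)" for t
  define K0 where "K0 = K (T + 1)"
  let ?K' = "\<lambda>s. real n * s ^ (n - 1) * (h s - c) + s ^ n * h' s"
  have K: "K t \<le> K0" if "t \<ge> T + 1" for t
    unfolding K0_def
  proof (rule nonincreasing_on_ray[of T K ?K'])
    fix s assume s: "s > T"
    show "(K has_real_derivative ?K' s) (at s)"
      unfolding K_def by (auto intro!: derivative_eq_intros der s)
    have "s ^ n = s * s ^ (n - 1)" using n by (simp add: power_eq_if)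
    then have "?K' s = real n * s ^ (n - 1) * (h s + s / real n * h' s - c)"
      using n by (simp add: algebra_simps)
    also have "\<dots> \<le> 0" using le[OF s] s T by (intro mult_nonneg_nonpos) auto
    finally show "?K' s \<le> 0" .
  qed (use that in auto)
  \<comment> \<open>Beyond this time \<open>\<bar>K0\<bar> / t\<close> is below
    \<open>d - c\<close>; the added 1 makes this strict and ensures that \<open>t\<close> is at most
    \<open>t ^ n\<close>.\<close>
  define t1 where "t1 = max (T + 1) (\<bar>K0\<bar> / (d - c) + 1)"
  show ?thesis using eventually_ge_at_top[of t1]
  proof eventually_elim
    case (elim t)
    then have t: "t \<ge> T + 1" "t \<ge> 1" "\<bar>K0\<bar> / (d - c) < t"
      using T by (auto simp: t1_def)
    then have "K0 < t * (d - c)" using \<open>c < d\<close> by (simp add: divide_less_eq)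
    also have "\<dots> \<le> t ^ n * (d - c)"
      using t n \<open>c < d\<close> by (intro mult_right_mono self_le_power) auto
    finally have "t ^ n * (h t - c) < t ^ n * (d - c)" using K[OF t(1)] by (simp add: K_def)
    then show ?case using t by (simp add: mult_less_cancel_left)
  qed
qed

lemma norm_power2_has_real_derivative:
  fixes a :: "real \<Rightarrow> 'a::real_inner"
  assumes "(a has_vector_derivative a') (at t)"
  shows "((\<lambda>t. (norm (a t))\<^sup>2) has_real_derivative 2 * (a t \<bullet> a')) (at t)"
proof -
  have "(\<lambda>h. a t \<bullet> (h *\<^sub>R a') + (h *\<^sub>R a') \<bullet> a t) = (*) (2 * (a t \<bullet> a'))"
    by (rule ext) (simp add: inner_commute)
  with has_derivative_inner[OF assms[unfolded has_vector_derivative_def]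
      assms[unfolded has_vector_derivative_def]]
  show ?thesis
    unfolding power2_norm_eq_inner has_field_derivative_def by metis
qed

lemma has_real_derivative_gradient_compose:
  fixes F :: "'a::real_inner \<Rightarrow> real"
  assumes "(F has_derivative (\<lambda>h. g \<bullet> h)) (at (y t))" "(y has_vector_derivative y') (at t)"
  shows "((\<lambda>t. F (y t)) has_real_derivative g \<bullet> y') (at t)"
proof -
  have "(\<lambda>h. g \<bullet> (h *\<^sub>R y')) = (*) (g \<bullet> y')"
    by (rule ext) simp
  with has_derivative_compose[OF assms(2)[unfolded has_vector_derivative_def] assms(1)]
  show ?thesis
    unfolding has_field_derivative_def by metis
qed

locale convex_gradient =
  fixes F :: "'a::{real_inner, complete_space} \<Rightarrow> real" and G :: "'a \<Rightarrow> 'a"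
  assumes F_derivative: "\<And>x. (F has_derivative (\<lambda>h. G x \<bullet> h)) (at x)"
    and F_subgradient: "\<And>x x'. F x + G x \<bullet> (x' - x) \<le> F x'"
    and F_nonneg: "\<And>x. 0 \<le> F x"
begin

lemma F_continuous: "continuous_on UNIV F"
  by (intro continuous_at_imp_continuous_on ballI has_derivative_continuous[OF F_derivative])

text \<open>Average the subgradient inequalities based at the intermediate point; their linear terms
  cancel.\<close>

lemma F_convex: "convex_on UNIV F"
proof (rule convex_onI)
  fix t :: real and x y :: 'a assume t: "t > 0" "t < 1"
  let ?m = "(1 - t) *\<^sub>R x + t *\<^sub>R y"
  have "(1 - t) * (F ?m + G ?m \<bullet> (x - ?m)) + t * (F ?m + G ?m \<bullet> (y - ?m)) \<le> (1 - t) * F x + t * F y"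
    using t by (intro add_mono mult_left_mono F_subgradient) auto
  moreover have "(1 - t) * (F ?m + G ?m \<bullet> (x - ?m)) + t * (F ?m + G ?m \<bullet> (y - ?m))
      = F ?m + G ?m \<bullet> ((1 - t) *\<^sub>R (x - ?m) + t *\<^sub>R (y - ?m))"
    by (simp add: inner_add_right algebra_simps)
  moreover have "(1 - t) *\<^sub>R (x - ?m) + t *\<^sub>R (y - ?m) = 0" by (simp add: algebra_simps)
  ultimately show "F ?m \<le> (1 - t) * F x + t * F y" by simp
qed simp

end

text \<open>The second order flow as a first order system in position \<open>y\<close> and velocity
  \<open>v\<close>, posed on an open ray so that derivatives are two-sided.\<close>

locale inertial_flow = convex_gradient F G
  for F :: "'a::{real_inner, complete_space} \<Rightarrow> real" and G +
  fixes y v :: "real \<Rightarrow> 'a" and \<alpha> T :: real and z :: 'a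
  assumes T: "T > 0" and alpha: "\<alpha> \<ge> 3" and min: "F z = 0"
    and y_derivative: "\<And>t. t > T \<Longrightarrow> (y has_vector_derivative v t) (at t)"
    and v_derivative: "\<And>t. t > T \<Longrightarrow>
      (v has_vector_derivative - ((\<alpha> + 1) / t) *\<^sub>R v t - (t / 4) *\<^sub>R G (y t)) (at t)"
begin

definition "anchor w t = \<alpha> *\<^sub>R (y t - w) + t *\<^sub>R v t"
text \<open>The reference point stays a parameter: the weak limit argument needs this energy for
  every minimizer, not only for \<open>z\<close>.\<close>

definition "energy w t = t ^ 3 / 4 * F (y t) + (norm (anchor w t))\<^sup>2 / 2"
definition "mech t = t ^ 3 / 4 * F (y t) + t\<^sup>2 / 2 * (norm (v t))\<^sup>2"

lemma F_y_derivative: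
  "t > T \<Longrightarrow> ((\<lambda>t. F (y t)) has_real_derivative G (y t) \<bullet> v t) (at t)"
  by (rule has_real_derivative_gradient_compose[OF F_derivative y_derivative])

text \<open>The damping coefficient \<open>(\<alpha> + 1) / t\<close> cancels the velocity terms
  exactly, leaving only the gradient.\<close>

lemma anchor_derivative:
  assumes "t > T"
  shows "(anchor w has_vector_derivative - (t\<^sup>2 / 4) *\<^sub>R G (y t)) (at t)"
proof -
  have "(anchor w has_vector_derivative
      \<alpha> *\<^sub>R (v t - 0) + (t *\<^sub>R (- ((\<alpha> + 1) / t) *\<^sub>R v t - (t / 4) *\<^sub>R G (y t)) + 1 *\<^sub>R v t)) (at t)"
    unfolding anchor_def
    by (intro has_vector_derivative_add has_vector_derivative_diff has_vector_derivative_scaleR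
        bounded_linear.has_vector_derivative[OF bounded_linear_scaleR_right]
        has_vector_derivative_const DERIV_ident y_derivative v_derivative assms)
  moreover have "t *\<^sub>R (- ((\<alpha> + 1) / t) *\<^sub>R v t - (t / 4) *\<^sub>R G (y t))
      = - (\<alpha> + 1) *\<^sub>R v t - (t\<^sup>2 / 4) *\<^sub>R G (y t)"
    using assms T by (simp add: scaleR_diff_right power2_eq_square) (simp add: algebra_simps)
  then have "\<alpha> *\<^sub>R (v t - 0) + (t *\<^sub>R (- ((\<alpha> + 1) / t) *\<^sub>R v t - (t / 4) *\<^sub>R G (y t)) + 1 *\<^sub>R v t)
      = - (t\<^sup>2 / 4) *\<^sub>R G (y t)"
    by (simp add: algebra_simps)
  ultimately show ?thesis by simp
qed

lemma weighted_value_derivative: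
  assumes "t > T"
  shows "((\<lambda>t. t ^ 3 / 4 * F (y t)) has_real_derivative
    3 * t\<^sup>2 / 4 * F (y t) + t ^ 3 / 4 * (G (y t) \<bullet> v t)) (at t)"
  by (auto intro!: derivative_eq_intros F_y_derivative assms)

text \<open>The weight \<open>t ^ 3 / 4\<close> is the one for which the products of gradient and
  velocity cancel.\<close>

lemma energy_derivative:
  assumes "t > T"
  shows "(energy w has_real_derivative 3 * t\<^sup>2 / 4 * F (y t) - \<alpha> * t\<^sup>2 / 4 * (G (y t) \<bullet> (y t - w))) (at t)"
proof -
  have "(energy w has_real_derivative 3 * t\<^sup>2 / 4 * F (y t) + t ^ 3 / 4 * (G (y t) \<bullet> v t)
      + 2 * (anchor w t \<bullet> (- (t\<^sup>2 / 4) *\<^sub>R G (y t))) / 2) (at t)"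
    unfolding energy_def
    by (intro DERIV_add DERIV_cdivide weighted_value_derivative norm_power2_has_real_derivative
        anchor_derivative assms)
  moreover have "anchor w t \<bullet> (- (t\<^sup>2 / 4) *\<^sub>R G (y t))
      = - (t\<^sup>2 / 4) * (\<alpha> * (G (y t) \<bullet> (y t - w)) + t * (G (y t) \<bullet> v t))"
    unfolding anchor_def inner_commute[of _ "- (t\<^sup>2 / 4) *\<^sub>R G (y t)"] by (simp add: inner_add_right) (simp add: field_simps)
  ultimately show ?thesis
    by (elim DERIV_cong) (simp add: algebra_simps power2_eq_square power3_eq_cube)
qed

text \<open>The products of gradient and velocity cancel again; damping contributes
  \<open>- (\<alpha> + 1)\<close> and the weight \<open>t\<^sup>2 / 2\<close> contributes 1 to the
  coefficient of the kinetic term.\<close>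

lemma mech_derivative:
  assumes "t > T"
  shows "(mech has_real_derivative 3 * t\<^sup>2 / 4 * F (y t) - \<alpha> * t * (norm (v t))\<^sup>2) (at t)"
proof -
  have half_sq: "((\<lambda>t. t\<^sup>2 / 2) has_real_derivative t) (at t)"
    by (auto intro!: derivative_eq_intros)
  let ?v' = "- ((\<alpha> + 1) / t) *\<^sub>R v t - (t / 4) *\<^sub>R G (y t)"
  have deriv: "(mech has_real_derivative 3 * t\<^sup>2 / 4 * F (y t) + t ^ 3 / 4 * (G (y t) \<bullet> v t)
      + (t * (norm (v t))\<^sup>2 + 2 * (v t \<bullet> ?v') * (t\<^sup>2 / 2))) (at t)"
    unfolding mech_def
    by (rule DERIV_add[OF weighted_value_derivative[OF assms]
          DERIV_mult[OF half_sq norm_power2_has_real_derivative[OF v_derivative[OF assms]]]])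
  have "v t \<bullet> ?v' = - ((\<alpha> + 1) / t) * (norm (v t))\<^sup>2 - t / 4 * (G (y t) \<bullet> v t)"
    by (simp add: inner_diff_right inner_commute power2_norm_eq_inner)
  moreover have "2 * (- ((\<alpha> + 1) / t) * n - t / 4 * g) * (t\<^sup>2 / 2) = - (\<alpha> + 1) * t * n - t ^ 3 / 4 * g" for n g
    using assms T by (simp add: field_simps power2_eq_square power3_eq_cube)
  ultimately have eq: "2 * (v t \<bullet> ?v') * (t\<^sup>2 / 2) = - (\<alpha> + 1) * t * (norm (v t))\<^sup>2 - t ^ 3 / 4 * (G (y t) \<bullet> v t)"
    by metis
  show ?thesis
    using deriv unfolding eq by (rule DERIV_cong) (simp add: algebra_simps)
qed

text \<open>Convexity and \<open>F w = 0\<close> bound \<open>F (y t)\<close> by the inner product,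
  which turns the two terms into the single coefficient \<open>3 / 4 - \<alpha> / 4\<close>.\<close>

lemma energy_derivative_le:
  assumes "F w = 0"
  shows "3 * t\<^sup>2 / 4 * F (y t) - \<alpha> * t\<^sup>2 / 4 * (G (y t) \<bullet> (y t - w)) \<le> - (\<alpha> - 3) / 4 * (t\<^sup>2 * F (y t))"
proof -
  have "F (y t) \<le> G (y t) \<bullet> (y t - w)"
    using F_subgradient[of "y t" w] assms by (simp add: inner_diff_right)
  then have "\<alpha> * t\<^sup>2 / 4 * F (y t) \<le> \<alpha> * t\<^sup>2 / 4 * (G (y t) \<bullet> (y t - w))"
    using alpha by (intro mult_left_mono) auto
  then show ?thesis by (simp add: algebra_simps)
qed

lemma energy_mono:
  assumes "F w = 0" "T < s" "s \<le> t"
  shows "energy w t \<le> energy w s"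
proof (rule nonincreasing_on_ray[OF energy_derivative _ assms(2,3)])
  fix t
  have "- (\<alpha> - 3) / 4 * (t\<^sup>2 * F (y t)) \<le> 0"
    using alpha F_nonneg by (intro mult_nonpos_nonneg) auto
  with energy_derivative_le[OF assms(1), of t]
  show "3 * t\<^sup>2 / 4 * F (y t) - \<alpha> * t\<^sup>2 / 4 * (G (y t) \<bullet> (y t - w)) \<le> 0" by linarith
qed

lemma energy_ge: "t > T \<Longrightarrow> t ^ 3 / 4 * F (y t) \<le> energy w t"
  by (simp add: energy_def)

lemma F_y_bounded: "\<exists>K. \<forall>t\<ge>T + 1. t ^ 3 * F (y t) \<le> K"
proof (intro exI allI impI)
  fix t assume "T + 1 \<le> t"
  then show "t ^ 3 * F (y t) \<le> 4 * energy z (T + 1)"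
    using energy_ge[of t z] energy_mono[OF min, of "T + 1" t] by simp
qed

section \<open>The strict case \<alpha> > 3: little-o rate and weak convergence\<close>

context
  assumes alpha_gt: "\<alpha> > 3"
begin

lemma energy_convergent:
  assumes "F w = 0"
  shows "\<exists>l. (energy w \<longlongrightarrow> l) at_top"
proof (rule nonincreasing_tendsto_at_top[of T _ 0])
  show "0 \<le> energy w t" if "t > T" for t
    using F_nonneg that T by (simp add: energy_def)
qed (rule energy_mono[OF assms])

lemma mech_nonneg: "t > T \<Longrightarrow> 0 \<le> mech t"
  using F_nonneg T by (simp add: mech_def)

definition "lyap t = mech t + 6 / (\<alpha> - 3) * energy z t"

text \<open>The coefficient of the energy is chosen so that its dissipation absorbs the positive term
  in the derivative of \<^const>\<open>mech\<close> and leaves \<^term>\<open>mech t / t\<close>, which is not integrable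
  if \<^const>\<open>mech\<close> has a positive limit.\<close>

lemma lyap_derivative:
  assumes "t > T"
  shows "\<exists>l'. (lyap has_real_derivative l') (at t) \<and> l' \<le> - (mech t / t)"
proof (intro exI conjI)
  let ?e = "3 * t\<^sup>2 / 4 * F (y t) - \<alpha> * t\<^sup>2 / 4 * (G (y t) \<bullet> (y t - z))"
  let ?l = "3 * t\<^sup>2 / 4 * F (y t) - \<alpha> * t * (norm (v t))\<^sup>2 + 6 / (\<alpha> - 3) * ?e"
  show "(lyap has_real_derivative ?l) (at t)"
    unfolding lyap_def
    by (intro DERIV_add DERIV_cmult mech_derivative energy_derivative assms)
  have "6 / (\<alpha> - 3) * ?e \<le> 6 / (\<alpha> - 3) * (- (\<alpha> - 3) / 4 * (t\<^sup>2 * F (y t)))"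
    using alpha_gt by (intro mult_left_mono energy_derivative_le min) auto
  also have "\<dots> = - (3 / 2) * (t\<^sup>2 * F (y t))" using alpha_gt by (simp add: field_simps)
  \<comment> \<open>The value coefficients add to 3/4 - 3/2 = -3/4, below the -1/4 that is needed;
    the kinetic term only needs \<open>\<alpha>\<close> to be at least 1/2.\<close>
  finally have "?l \<le> - (3 / 4) * (t\<^sup>2 * F (y t)) - \<alpha> * (t * (norm (v t))\<^sup>2)" by simp
  moreover have "mech t / t = 1 / 4 * (t\<^sup>2 * F (y t)) + 1 / 2 * (t * (norm (v t))\<^sup>2)"
    using assms T by (simp add: mech_def field_simps power2_eq_square power3_eq_cube)
  moreover have "0 \<le> t\<^sup>2 * F (y t)" using F_nonneg by simp
  moreover have "1 / 2 * (t * (norm (v t))\<^sup>2) \<le> \<alpha> * (t * (norm (v t))\<^sup>2)"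
    using assms T alpha by (intro mult_right_mono) auto
  ultimately show "?l \<le> - (mech t / t)" by linarith
qed

text \<open>Both \<open>lyap\<close> and \<open>energy z\<close> are nonincreasing and nonnegative,
  so \<open>mech\<close> converges as a combination of them. If its limit \<open>m\<close> were
  positive, \<open>lyap t + m / 2 * ln t\<close> would eventually be nonincreasing, and the growth
  of the logarithm would drive \<open>lyap\<close> below 0.\<close>

lemma mech_tendsto_0: "(mech \<longlongrightarrow> 0) at_top"
proof -
  obtain l' where l': "\<And>t. t > T \<Longrightarrow> (lyap has_real_derivative l' t) (at t)"
    "\<And>t. t > T \<Longrightarrow> l' t \<le> - (mech t / t)"
    using lyap_derivative by metis
  have nonneg: "0 \<le> lyap t" if "t > T" for t
    using mech_nonneg[OF that] alpha_gt F_nonneg T that by (simp add: lyap_def energy_def)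
  have "\<exists>l. (lyap \<longlongrightarrow> l) at_top"
  proof (rule nonincreasing_tendsto_at_top[OF nonincreasing_on_ray[OF l'(1)] nonneg])
    show "l' t \<le> 0" if "t > T" for t
      using l'(2)[OF that] mech_nonneg[OF that] T that by (smt (verit) divide_nonneg_pos)
  qed
  then obtain a b where "(lyap \<longlongrightarrow> a) at_top" "(energy z \<longlongrightarrow> b) at_top"
    using energy_convergent[OF min] by blast
  then have "((\<lambda>t. lyap t - 6 / (\<alpha> - 3) * energy z t) \<longlongrightarrow> a - 6 / (\<alpha> - 3) * b) at_top"
    by (intro tendsto_intros)
  then obtain m where m: "(mech \<longlongrightarrow> m) at_top" by (auto simp: lyap_def)
  have "m \<ge> 0"
    by (rule tendsto_lowerbound[OF m])
      (use eventually_mono[OF eventually_gt_at_top mech_nonneg] in auto)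
  moreover have False if "m > 0"
  proof -
    have "\<forall>\<^sub>F t in at_top. m / 2 < mech t" using order_tendstoD(1)[OF m, of "m / 2"] that by simp
    then obtain s0 where s0: "\<And>t. t \<ge> s0 \<Longrightarrow> m / 2 < mech t"
      by (auto simp: eventually_at_top_linorder)
    define s where "s = max s0 T"
    have s: "s \<ge> T" "s > 0" using T by (auto simp: s_def)
    have mono: "lyap t + m / 2 * ln t \<le> lyap (s + 1) + m / 2 * ln (s + 1)" if "s + 1 \<le> t" for t
    proof (rule nonincreasing_on_ray[of s "\<lambda>t. lyap t + m / 2 * ln t" "\<lambda>t. l' t + m / 2 * (1 / t)"])
      fix x assume x: "x > s"
      then show "((\<lambda>t. lyap t + m / 2 * ln t) has_real_derivative l' x + m / 2 * (1 / x)) (at x)"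
        using s by (auto intro!: derivative_eq_intros l'(1))
      have "m / 2 * (1 / x) \<le> mech x / x"
        using divide_right_mono[of "m / 2" "mech x" x] s0[of x] x s by (simp add: s_def)
      then show "l' x + m / 2 * (1 / x) \<le> 0" using l'(2)[of x] x s by simp
    qed (use that in auto)
    have "\<forall>\<^sub>F t in at_top. (lyap (s + 1) + m / 2 * ln (s + 1)) / (m / 2) < ln t"
      using ln_at_top filterlim_at_top_dense by blast
    then have "\<forall>\<^sub>F t::real in at_top. False"
      using eventually_ge_at_top[of "s + 1"]
    proof eventually_elim
      case (elim t)
      then have "lyap (s + 1) + m / 2 * ln (s + 1) < m / 2 * ln t"
        using that by (simp add: divide_less_eq mult.commute)
      then show False using mono[OF elim(2)] nonneg[of t] elim(2) s by simp
    qed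
    then show False by simp
  qed
  ultimately have "m = 0" by (cases "m > 0") auto
  with m show ?thesis by simp
qed

lemma F_y_rate: "((\<lambda>t. t ^ 3 * F (y t)) \<longlongrightarrow> 0) at_top"
proof (rule tendsto_sandwich[OF _ _ tendsto_const])
  show "\<forall>\<^sub>F t in at_top. 0 \<le> t ^ 3 * F (y t)"
    using eventually_gt_at_top[of 0] by eventually_elim (simp add: F_nonneg)
  show "\<forall>\<^sub>F t in at_top. t ^ 3 * F (y t) \<le> 4 * mech t"
    by (rule always_eventually) (simp add: mech_def)
  show "((\<lambda>t. 4 * mech t) \<longlongrightarrow> 0) at_top"
    using tendsto_mult_left[OF mech_tendsto_0, of 4] by simp
qed

lemma F_y_tendsto_0: "((\<lambda>t. F (y t)) \<longlongrightarrow> 0) at_top"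
proof (rule tendsto_sandwich[OF _ _ tendsto_const F_y_rate])
  show "\<forall>\<^sub>F t in at_top. 0 \<le> F (y t)" by (simp add: F_nonneg)
  show "\<forall>\<^sub>F t in at_top. F (y t) \<le> t ^ 3 * F (y t)"
    using eventually_ge_at_top[of 1]
  proof eventually_elim
    case (elim t)
    then show ?case using mult_right_mono[of 1 "t ^ 3" "F (y t)"] F_nonneg by simp
  qed
qed

lemma velocity_tendsto_0: "((\<lambda>t. t *\<^sub>R v t) \<longlongrightarrow> 0) at_top"
proof (rule tendsto_norm_zero_cancel)
  have "((\<lambda>t. sqrt (2 * mech t)) \<longlongrightarrow> sqrt (2 * 0)) at_top"
    by (intro tendsto_intros mech_tendsto_0)
  then have lim: "((\<lambda>t. sqrt (2 * mech t)) \<longlongrightarrow> 0) at_top" by simp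
  show "((\<lambda>t. norm (t *\<^sub>R v t)) \<longlongrightarrow> 0) at_top"
  proof (rule tendsto_sandwich[OF _ _ tendsto_const lim])
    show "\<forall>\<^sub>F t in at_top. norm (t *\<^sub>R v t) \<le> sqrt (2 * mech t)"
      using eventually_gt_at_top[of 0]
    proof eventually_elim
      case (elim t)
      then have "(norm (t *\<^sub>R v t))\<^sup>2 \<le> 2 * mech t"
        using F_nonneg by (simp add: mech_def power_mult_distrib)
      then show ?case by (rule real_le_rsqrt)
    qed
  qed simp
qed

text \<open>The energy converges and its value part vanishes, so the norm of \<open>anchor w\<close>
  converges. Since \<open>t *\<^sub>R v t\<close> tends to 0, \<open>\<alpha>\<close> times the
  distance to \<open>w\<close> has the same limit.\<close>

lemma dist_y_convergent:
  assumes "F w = 0"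
  shows "\<exists>l. ((\<lambda>t. norm (y t - w)) \<longlongrightarrow> l) at_top"
proof -
  obtain e where "(energy w \<longlongrightarrow> e) at_top" using energy_convergent[OF assms] by blast
  then have "((\<lambda>t. sqrt (2 * (energy w t - 1 / 4 * (t ^ 3 * F (y t))))) \<longlongrightarrow> sqrt (2 * (e - 1 / 4 * 0))) at_top"
    by (intro tendsto_intros F_y_rate)
  then have lim: "((\<lambda>t. norm (anchor w t)) \<longlongrightarrow> sqrt (2 * e)) at_top"
    by (simp add: energy_def)
  have "((\<lambda>t. norm (anchor w t) - norm (\<alpha> *\<^sub>R (y t - w))) \<longlongrightarrow> 0) at_top"
  proof (rule Lim_null_comparison)
    show "\<forall>\<^sub>F t in at_top. norm (norm (anchor w t) - norm (\<alpha> *\<^sub>R (y t - w))) \<le> norm (t *\<^sub>R v t)"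
    proof (intro always_eventually allI)
      fix t
      show "norm (norm (anchor w t) - norm (\<alpha> *\<^sub>R (y t - w))) \<le> norm (t *\<^sub>R v t)"
        using norm_triangle_ineq3[of "anchor w t" "\<alpha> *\<^sub>R (y t - w)"] by (simp add: anchor_def)
    qed
    show "((\<lambda>t. norm (t *\<^sub>R v t)) \<longlongrightarrow> 0) at_top" by (rule tendsto_norm_zero[OF velocity_tendsto_0])
  qed
  then have "((\<lambda>t. (norm (anchor w t) - (norm (anchor w t) - norm (\<alpha> *\<^sub>R (y t - w)))) / \<alpha>)
      \<longlongrightarrow> (sqrt (2 * e) - 0) / \<alpha>) at_top"
    using alpha by (intro tendsto_intros lim) auto
  then show ?thesis using alpha by auto
qed

lemma y_weak_convergence: "\<exists>p. F p = 0 \<and> weak_conv_at_top y p"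
  using opial_convex[OF F_convex F_continuous F_nonneg min F_y_tendsto_0] dist_y_convergent by blast

end

end

section \<open>Transfer of rates and weak limits from \<open>y\<close> to its weighted average
  \<open>u\<close>\<close>

locale averaged_flow = inertial_flow +
  fixes u u' :: "real \<Rightarrow> 'a"
  assumes u_derivative: "\<And>t. t > T \<Longrightarrow> (u has_vector_derivative u' t) (at t)"
    and y_eq: "\<And>t. t > T \<Longrightarrow> y t = u t + (t / 4) *\<^sub>R u' t"
begin

text \<open>For \<open>h t = t ^ 3 * F (u t)\<close> the combination \<open>h + t * h'\<close> is
  \<open>4 * t ^ 3\<close> times the linearization of \<open>F\<close> at \<open>u t\<close>
  evaluated at \<open>y t\<close>, hence at most \<open>4 * t ^ 3 * F (y t)\<close> by convexity.
  This is the source of the factor 4.\<close>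

lemma F_u_less:
  assumes bound: "\<forall>\<^sub>F t in at_top. t ^ 3 * F (y t) \<le> c" and "4 * c < d"
  shows "\<forall>\<^sub>F t in at_top. t ^ 3 * F (u t) < d"
proof -
  obtain s0 where s0: "\<And>t. t \<ge> s0 \<Longrightarrow> t ^ 3 * F (y t) \<le> c"
    using bound by (auto simp: eventually_at_top_linorder)
  let ?h' = "\<lambda>t. 3 * t\<^sup>2 * F (u t) + t ^ 3 * (G (u t) \<bullet> u' t)"
  show ?thesis
  proof (rule weighted_average_less[of 1 "max s0 T" _ ?h' "4 * c"])
    fix t assume "t > max s0 T"
    then have t: "t > s0" "t > T" by auto
    show "((\<lambda>t. t ^ 3 * F (u t)) has_real_derivative ?h' t) (at t)"
      using has_real_derivative_gradient_compose[OF F_derivative u_derivative[OF t(2)]]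
      by (auto intro!: derivative_eq_intros)
    have "t ^ 3 * F (u t) + t / real 1 * ?h' t = 4 * (t ^ 3 * (F (u t) + G (u t) \<bullet> (y t - u t)))"
      by (simp add: y_eq[OF t(2)] algebra_simps power2_eq_square power3_eq_cube)
    also have "\<dots> \<le> 4 * (t ^ 3 * F (y t))"
      using t T by (intro mult_left_mono F_subgradient) auto
    also have "\<dots> \<le> 4 * c" using s0[of t] t by simp
    finally show "t ^ 3 * F (u t) + t / real 1 * ?h' t \<le> 4 * c" .
  qed (use T \<open>4 * c < d\<close> in auto)
qed

lemma inner_u_less:
  assumes "((\<lambda>t. y t \<bullet> w) \<longlongrightarrow> p \<bullet> w) at_top" "p \<bullet> w < d"
  shows "\<forall>\<^sub>F t in at_top. u t \<bullet> w < d"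
proof -
  \<comment> \<open>The averaging lemma needs a strict gap, so a level between the limit and
    \<open>d\<close> is inserted; the exponent 4 below reproduces \<open>y\<close> exactly.\<close>
  obtain c where c: "p \<bullet> w < c" "c < d" using assms(2) dense by blast
  obtain s0 where s0: "\<And>t. t \<ge> s0 \<Longrightarrow> y t \<bullet> w < c"
    using order_tendstoD(2)[OF assms(1) c(1)] by (auto simp: eventually_at_top_linorder)
  show ?thesis
  proof (rule weighted_average_less[of 4 "max s0 T" _ "\<lambda>t. u' t \<bullet> w" c])
    fix t assume "t > max s0 T"
    then have t: "t > s0" "t > T" by auto
    show "((\<lambda>t. u t \<bullet> w) has_real_derivative u' t \<bullet> w) (at t)"
      using bounded_linear.has_vector_derivative[OF bounded_linear_inner_left u_derivative[OF t(2)]]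
      by (simp add: has_real_derivative_iff_has_vector_derivative)
    show "u t \<bullet> w + t / real 4 * (u' t \<bullet> w) \<le> c"
      using s0[of t] t by (simp add: y_eq inner_add_left)
  qed (use T c in auto)
qed

lemma u_weak_convergence:
  assumes "weak_conv_at_top y p"
  shows "weak_conv_at_top u p"
  unfolding weak_conv_at_top_def
proof (intro allI order_tendstoI)
  fix w a
  have lim: "((\<lambda>t. y t \<bullet> x) \<longlongrightarrow> p \<bullet> x) at_top" for x
    using assms by (simp add: weak_conv_at_top_def)
  show "\<forall>\<^sub>F t in at_top. u t \<bullet> w < a" if "p \<bullet> w < a"
    by (rule inner_u_less[OF lim that])
  show "\<forall>\<^sub>F t in at_top. a < u t \<bullet> w" if "a < p \<bullet> w"
    \<comment> \<open>The lower bound is the upper bound for the opposite direction.\<close>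
    using inner_u_less[OF lim, of "- w" "- a"] that by simp
qed

end

section \<open>The third order equation\<close>

text \<open>The domination by \<open>k\<close> lets one estimate serve both the envelope gap, with
  \<open>g = k\<close>, and the smaller gap at the proximal point.\<close>

lemma cubic_rate_bigo:
  fixes g k :: "real \<Rightarrow> real"
  assumes "\<And>t. 0 \<le> g t" "\<And>t. g t \<le> k t" "\<forall>\<^sub>F t in at_top. t ^ 3 * k t \<le> K"
  shows "g \<in> O[at_top](\<lambda>t. 1 / t ^ 3)"
proof (rule bigoI[of _ K])
  show "\<forall>\<^sub>F t in at_top. norm (g t) \<le> K * norm (1 / t ^ 3)"
    using assms(3) eventually_gt_at_top[of 0]
  proof eventually_elim
    case (elim t)
    have "t ^ 3 * g t \<le> t ^ 3 * k t"
      using assms(2) elim(2) by (intro mult_left_mono) auto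
    then have "t ^ 3 * g t \<le> K" using elim(1) by linarith
    then show ?case using elim(2) assms(1)[of t] by (simp add: field_simps)
  qed
qed

lemma cubic_rate_smallo:
  fixes g k :: "real \<Rightarrow> real"
  assumes "\<And>t. 0 \<le> g t" "\<And>t. g t \<le> k t"
    and "\<And>e. e > 0 \<Longrightarrow> \<forall>\<^sub>F t in at_top. t ^ 3 * k t < e"
  shows "g \<in> o[at_top](\<lambda>t. 1 / t ^ 3)"
proof (rule landau_o.smallI)
  fix c :: real assume "c > 0"
  show "\<forall>\<^sub>F t in at_top. norm (g t) \<le> c * norm (1 / t ^ 3)"
    using assms(3)[OF \<open>c > 0\<close>] eventually_gt_at_top[of 0]
  proof eventually_elim
    case (elim t)
    have "t ^ 3 * g t \<le> t ^ 3 * k t"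
      using assms(2) elim(2) by (intro mult_left_mono) auto
    then have "t ^ 3 * g t \<le> c" using elim(1) by linarith
    then show ?case using elim(2) assms(1)[of t] by (simp add: field_simps)
  qed
qed

theorem theorem6p1:
  fixes f :: "'a::{real_inner, complete_space} \<Rightarrow> ereal"
    and lam t0 \<alpha> :: real
    and u u1 u2 u3 :: "real \<Rightarrow> 'a"
  assumes conv: "convex_ext f" and lsc: "lsc_ext f" and proper: "proper_fun f"
    and argmin_ne: "argmin_set f \<noteq> {}"
    and lam: "lam > 0" and t0: "t0 > 0" and alpha: "\<alpha> \<ge> 0"
    and d1: "\<And>t. t \<ge> t0 \<Longrightarrow> (u has_vector_derivative u1 t) (at t within {t0..})"
    and d2: "\<And>t. t \<ge> t0 \<Longrightarrow> (u1 has_vector_derivative u2 t) (at t within {t0..})"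
    and d3: "\<And>t. t \<ge> t0 \<Longrightarrow> (u2 has_vector_derivative u3 t) (at t within {t0..})"
    and cont3: "continuous_on {t0..} u3"
    and ode: "\<And>t. t \<ge> t0 \<Longrightarrow>
        u3 t + ((\<alpha> + 7) / t) *\<^sub>R u2 t + (5 * (\<alpha> + 1) / t^2) *\<^sub>R u1 t
        + grad (moreau_env f lam) (u t + (t / 4) *\<^sub>R u1 t) = 0"
  shows
   "(\<alpha> \<ge> 3 \<longrightarrow>
      (\<lambda>t. moreau_env f lam (u t + (t / 4) *\<^sub>R u1 t) - real_of_ereal (Inf (range f)))
         \<in> O[at_top](\<lambda>t. 1 / t^3) \<and>
      (\<lambda>t. real_of_ereal (f (prox f lam (u t + (t / 4) *\<^sub>R u1 t))) - real_of_ereal (Inf (range f)))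
         \<in> O[at_top](\<lambda>t. 1 / t^3) \<and>
      (\<lambda>t. moreau_env f lam (u t) - real_of_ereal (Inf (range f)))
         \<in> O[at_top](\<lambda>t. 1 / t^3) \<and>
      (\<lambda>t. real_of_ereal (f (prox f lam (u t))) - real_of_ereal (Inf (range f)))
         \<in> O[at_top](\<lambda>t. 1 / t^3))
    \<and>
    (\<alpha> > 3 \<longrightarrow>
      (\<lambda>t. moreau_env f lam (u t + (t / 4) *\<^sub>R u1 t) - real_of_ereal (Inf (range f)))
         \<in> o[at_top](\<lambda>t. 1 / t^3) \<and>
      (\<lambda>t. real_of_ereal (f (prox f lam (u t + (t / 4) *\<^sub>R u1 t))) - real_of_ereal (Inf (range f)))
         \<in> o[at_top](\<lambda>t. 1 / t^3) \<and>
      (\<lambda>t. moreau_env f lam (u t) - real_of_ereal (Inf (range f)))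
         \<in> o[at_top](\<lambda>t. 1 / t^3) \<and>
      (\<lambda>t. real_of_ereal (f (prox f lam (u t))) - real_of_ereal (Inf (range f)))
         \<in> o[at_top](\<lambda>t. 1 / t^3) \<and>
      (\<exists>u_inf \<in> argmin_set f. weak_conv_at_top u u_inf))"
proof -
  interpret M: convex_lsc f lam
    by unfold_locales (fact conv lsc proper argmin_ne lam)+
  interpret C: convex_gradient M.env M.env_grad
  proof
    show "0 \<le> M.env x" for x
      using M.prox_value_nonneg M.prox_value_le by (rule order_trans)
  qed (fact M.env_has_derivative M.env_subgradient)+
  obtain z where z: "M.env z = 0" using argmin_ne M.env_eq_0_iff by blast
  define y where "y t = u t + (t / 4) *\<^sub>R u1 t" for t
  define v where "v t = (5 / 4) *\<^sub>R u1 t + (t / 4) *\<^sub>R u2 t" for t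
  \<comment> \<open>The derivative at \<open>t0\<close> is one-sided; on the open ray the
    restriction to \<open>{t0..}\<close> disappears.\<close>
  have interior: "(w has_vector_derivative w') (at t)"
    if "(w has_vector_derivative w') (at t within {t0..})" "t > t0" for w :: "real \<Rightarrow> 'a" and w' t
  proof -
    have "(w has_vector_derivative w') (at t within {t0<..})"
      by (rule has_vector_derivative_within_subset[OF that(1)]) auto
    then show ?thesis using that(2) by (simp add: at_within_open[of t "{t0<..}"])
  qed
  note d = interior[OF d1] interior[OF d2] interior[OF d3]
  have quarter: "((\<lambda>t. t / 4) has_real_derivative 1 / 4) (at t)" for t :: real
    by (auto intro!: derivative_eq_intros)
  have dy: "(y has_vector_derivative v t) (at t)" if t: "t > t0" for t
  proof -
    have "(y has_vector_derivative u1 t + ((t / 4) *\<^sub>R u2 t + (1 / 4) *\<^sub>R u1 t)) (at t)"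
      unfolding y_def
      by (intro has_vector_derivative_add has_vector_derivative_scaleR quarter d) (use t in auto)
    moreover have "u1 t + ((t / 4) *\<^sub>R u2 t + (1 / 4) *\<^sub>R u1 t) = v t"
      using scaleR_left_distrib[of 1 "1 / 4" "u1 t"] by (simp add: v_def algebra_simps)
    ultimately show ?thesis by simp
  qed
  have dv: "(v has_vector_derivative - ((\<alpha> + 1) / t) *\<^sub>R v t - (t / 4) *\<^sub>R M.env_grad (y t)) (at t)"
    if t: "t > t0" for t
  proof -
    have "(v has_vector_derivative (5 / 4) *\<^sub>R u2 t + ((t / 4) *\<^sub>R u3 t + (1 / 4) *\<^sub>R u2 t)) (at t)"
      unfolding v_def
      by (intro has_vector_derivative_add has_vector_derivative_scaleR quarter d
          bounded_linear.has_vector_derivative[OF bounded_linear_scaleR_right]) (use t in auto)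
    moreover have "(5 / 4) *\<^sub>R u2 t + ((t / 4) *\<^sub>R u3 t + (1 / 4) *\<^sub>R u2 t)
        = - ((\<alpha> + 1) / t) *\<^sub>R v t - (t / 4) *\<^sub>R M.env_grad (y t)"
    proof -
      let ?G = "M.env_grad (y t)"
      have tpos: "t > 0" using t t0 by simp
      have "u3 t + ((\<alpha> + 7) / t) *\<^sub>R u2 t + (5 * (\<alpha> + 1) / t\<^sup>2) *\<^sub>R u1 t + ?G = 0"
        using ode[of t] t by (simp add: y_def M.grad_moreau_env)
      then have u3: "u3 t = - (((\<alpha> + 7) / t) *\<^sub>R u2 t + (5 * (\<alpha> + 1) / t\<^sup>2) *\<^sub>R u1 t + ?G)"
        by (simp only: eq_neg_iff_add_eq_0 add.assoc)
      have "(5 / 4) *\<^sub>R x + ((t / 4) *\<^sub>R (- (a *\<^sub>R x + b *\<^sub>R w + g)) + (1 / 4) *\<^sub>R x)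
          = (5 / 4 - t / 4 * a + 1 / 4) *\<^sub>R x - (t / 4 * b) *\<^sub>R w - (t / 4) *\<^sub>R g" for a b and x w g :: 'a
        by (simp add: scaleR_right_distrib scaleR_left_distrib scaleR_left_diff_distrib)
          (simp add: algebra_simps flip: scaleR_left_distrib)
      then have "(5 / 4) *\<^sub>R u2 t + ((t / 4) *\<^sub>R u3 t + (1 / 4) *\<^sub>R u2 t)
          = (5 / 4 - t / 4 * ((\<alpha> + 7) / t) + 1 / 4) *\<^sub>R u2 t
            - (t / 4 * (5 * (\<alpha> + 1) / t\<^sup>2)) *\<^sub>R u1 t - (t / 4) *\<^sub>R ?G"
        unfolding u3 by blast
      \<comment> \<open>Since 6/4 - (\<alpha> + 7)/4 = -(\<alpha> + 1)/4, the terms in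
        \<open>u1\<close> and \<open>u2\<close> recombine into a multiple of \<open>v\<close>; this
        is where the coefficients of the third order equation fit together.\<close>
      also have "5 / 4 - t / 4 * ((\<alpha> + 7) / t) + 1 / 4 = - ((\<alpha> + 1) / t) * (t / 4)"
        using tpos by (simp add: field_simps)
      also have "t / 4 * (5 * (\<alpha> + 1) / t\<^sup>2) = (\<alpha> + 1) / t * (5 / 4)"
        using tpos by (simp add: field_simps power2_eq_square)
      finally show ?thesis by (simp add: v_def scaleR_right_distrib)
    qed
    ultimately show ?thesis by simp
  qed
  have flow: "averaged_flow M.env M.env_grad y v \<alpha> t0 z u u1" if "\<alpha> \<ge> 3"
    by unfold_locales (use t0 that z dy dv d in \<open>auto simp: y_def\<close>)
  have env: "moreau_env f lam x - real_of_ereal (Inf (range f)) = M.env x" for x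
    by (simp add: M.env_def M.minval_def)
  define r where "r x = real_of_ereal (f (prox f lam x)) - real_of_ereal (Inf (range f))" for x
  have r: "0 \<le> r x" "r x \<le> M.env x" for x
    using M.prox_value_nonneg M.prox_value_le by (simp_all add: r_def M.minval_def M.fr_def)
  have big: "M.env \<circ> y \<in> O[at_top](\<lambda>t. 1 / t ^ 3) \<and> r \<circ> y \<in> O[at_top](\<lambda>t. 1 / t ^ 3) \<and>
      M.env \<circ> u \<in> O[at_top](\<lambda>t. 1 / t ^ 3) \<and> r \<circ> u \<in> O[at_top](\<lambda>t. 1 / t ^ 3)" if "\<alpha> \<ge> 3"
  proof -
    interpret A: averaged_flow M.env M.env_grad y v \<alpha> t0 z u u1 by (rule flow[OF that])
    obtain K where "\<And>t. t \<ge> t0 + 1 \<Longrightarrow> t ^ 3 * M.env (y t) \<le> K"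
      using A.F_y_bounded by blast
    then have Y: "\<forall>\<^sub>F t in at_top. t ^ 3 * M.env (y t) \<le> K"
      by (intro eventually_at_top_linorderI[of "t0 + 1"]) auto
    have "\<forall>\<^sub>F t in at_top. t ^ 3 * M.env (u t) < 4 * K + 1"
      by (rule A.F_u_less[OF Y]) simp
    then have U: "\<forall>\<^sub>F t in at_top. t ^ 3 * M.env (u t) \<le> 4 * K + 1"
      by (rule eventually_mono) simp
    show ?thesis
      using cubic_rate_bigo[OF _ _ Y] cubic_rate_bigo[OF _ _ U] r C.F_nonneg
      by (simp add: o_def)
  qed
  have small: "M.env \<circ> y \<in> o[at_top](\<lambda>t. 1 / t ^ 3) \<and> r \<circ> y \<in> o[at_top](\<lambda>t. 1 / t ^ 3) \<and>
      M.env \<circ> u \<in> o[at_top](\<lambda>t. 1 / t ^ 3) \<and> r \<circ> u \<in> o[at_top](\<lambda>t. 1 / t ^ 3) \<and>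
      (\<exists>u_inf \<in> argmin_set f. weak_conv_at_top u u_inf)" if "\<alpha> > 3"
  proof -
    interpret A: averaged_flow M.env M.env_grad y v \<alpha> t0 z u u1
      using flow that by simp
    have Y: "\<forall>\<^sub>F t in at_top. t ^ 3 * M.env (y t) < e" if "e > 0" for e
      using order_tendstoD(2)[OF A.F_y_rate[OF \<open>\<alpha> > 3\<close>] that] .
    have U: "\<forall>\<^sub>F t in at_top. t ^ 3 * M.env (u t) < e" if "e > 0" for e
    proof (rule A.F_u_less)
      \<comment> \<open>The averaging step multiplies the bound by 4, and 4 * \<open>e / 8\<close>
        is still strictly below \<open>e\<close>.\<close>
      show "\<forall>\<^sub>F t in at_top. t ^ 3 * M.env (y t) \<le> e / 8"
        by (rule eventually_mono[OF Y[of "e / 8"]]) (use that in auto)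
    qed (use that in simp)
    obtain p where "M.env p = 0" "weak_conv_at_top y p"
      using A.y_weak_convergence[OF \<open>\<alpha> > 3\<close>] by blast
    then have "p \<in> argmin_set f" "weak_conv_at_top u p"
      using A.u_weak_convergence M.env_eq_0_iff by blast+
    moreover have "M.env \<circ> y \<in> o[at_top](\<lambda>t. 1 / t ^ 3)" "r \<circ> y \<in> o[at_top](\<lambda>t. 1 / t ^ 3)"
      using cubic_rate_smallo[OF _ _ Y] r C.F_nonneg by (simp_all add: o_def)
    moreover have "M.env \<circ> u \<in> o[at_top](\<lambda>t. 1 / t ^ 3)" "r \<circ> u \<in> o[at_top](\<lambda>t. 1 / t ^ 3)"
      using cubic_rate_smallo[OF _ _ U] r C.F_nonneg by (simp_all add: o_def)
    ultimately show ?thesis by blast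
  qed
  show ?thesis
    using big small unfolding env r_def[symmetric] y_def[symmetric] o_def by blast
qed

end
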